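(* Let $V,W$ be finite-dimensional vector spaces over $\mathbb{F}_q$, and let $\varphi_V:\mathbb{F}_q^\nu\to V$, $\varphi_W:\mathbb{F}_q^\nu\to W$ be parent functions of spanning projective point families $\mathcal{F}_V\subset V$, $\mathcal{F}_W\subset W$ (each of size $\nu$), with parent codes $P_V=\ker\varphi_V$, $P_W=\ker\varphi_W$. Let $\mathcal{H}(P_V,P_W)$ be the set of linear Hamming isometries $\hat L$ of $\mathbb{F}_q^\nu$ with $\hat L(P_V)=P_W$, and $\mathrm{Isom}_{\mathcal{F}}(V,W)$ the set of projective isometries $(V,\operatorname{wt}_{\mathcal{F}_V})\to(W,\operatorname{wt}_{\mathcal{F}_W})$. Then: (a) for every $\hat L\in\mathcal{H}(P_V,P_W)$ there is a unique $L\in\mathrm{Isom}_{\mathcal{F}}(V,W)$ with $L\circ\varphi_V=\varphi_W\circ\hat L$, and the map $\Phi:\hat L\mapsto L$ is a bijection $\mathcal{H}(P_V,P_W)\to\mathrm{Isom}_{\mathcal{F}}(V,W)$; (b) $\Phi$ is compatible with composition: for three such spaces $U_1,U_2,U_3$ with parent functions and parent codes $P_1,P_2,P_3$, and $\hat L\in\mathcal{H}(P_1,P_2)$, $\hat T\in\mathcal{H}(P_2,P_3)$, one has $\Phi(\hat T\circ\hat L)=\Phi(\hat T)\circ\Phi(\hat L)$; (c) for any linear subspaces $\mathcal{D}_V\le V$, $\mathcal{D}_W\le W$, $\Phi$ restricts to a bijection from $\{\hat L\in\mathcal{H}(P_V,P_W):\hat L(\varphi_V^{-1}(\mathcal{D}_V))=\varphi_W^{-1}(\mathcal{D}_W)\}$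 onto $\{L\in\mathrm{Isom}_{\mathcal{F}}(V,W): L(\mathcal{D}_V)=\mathcal{D}_W\}$.
   Context: A spanning projective point family in $V$ is a set $\mathcal{F}$ of pairwise linearly independent nonzero vectors (distinct 1-dimensional subspaces) spanning $V$; its projective weight is $\operatorname{wt}_{\mathcal{F}}(x)=\min\{|I|:I\subseteq\mathcal{F},x\in\langle I\rangle\}$. A parent function of $\mathcal{F}$ with $|\mathcal{F}|=\nu$ is a linear map $\varphi:\mathbb{F}_q^\nu\to V$ with $\{\langle\varphi(e_i)\rangle\}_{i=1}^\nu=\mathcal{F}$ ($e_i$ standard basis vectors); $\ker\varphi$ is the parent code. A linear Hamming isometry of $\mathbb{F}_q^\nu$ is a linear bijection preserving Hamming weight. A projective isometry $V\to W$ is an invertible linear map $L$ with $\operatorname{wt}_{\mathcal{F}_W}(L(x))=\operatorname{wt}_{\mathcal{F}_V}(x)$ for all $x$. *)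

theory Defs
  imports "HOL-Analysis.Analysis"
begin

text \<open>Ambient field: a finite field F_q, rendered as a type 'a of class {finite, field}.
  A vector space V over it is a type 'v with scalar multiplication sV.
  The coordinate space F_q^nu is 'a^'i for a finite index type 'i, nu = CARD('i).\<close>

definition fd_space :: "('a::field \<Rightarrow> 'v::ab_group_add \<Rightarrow> 'v) \<Rightarrow> bool" where
  "fd_space sV \<longleftrightarrow> vector_space sV \<and> (\<exists>B. finite_dimensional_vector_space sV B)"

text \<open>Spanning projective point family: pairwise linearly independent nonzero vectors spanning V.\<close>
definition spanning_ppf :: "('a::field \<Rightarrow> 'v::ab_group_add \<Rightarrow> 'v) \<Rightarrow> 'v set \<Rightarrow> bool" where
  "spanning_ppf sV F \<longleftrightarrow>
     0 \<notin> F \<and>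
     (\<forall>x\<in>F. \<forall>y\<in>F. x \<noteq> y \<longrightarrow> \<not> module.dependent sV {x, y}) \<and>
     module.span sV F = UNIV"

text \<open>Projective weight.\<close>
definition proj_wt :: "('a::field \<Rightarrow> 'v::ab_group_add \<Rightarrow> 'v) \<Rightarrow> 'v set \<Rightarrow> 'v \<Rightarrow> nat" where
  "proj_wt sV F x = (LEAST n. \<exists>I. I \<subseteq> F \<and> finite I \<and> card I = n \<and> x \<in> module.span sV I)"

text \<open>Parent function of F (with |F| = nu = CARD('i)).\<close>
definition parent_fun ::
  "('a::field \<Rightarrow> 'v::ab_group_add \<Rightarrow> 'v) \<Rightarrow> 'v set \<Rightarrow> ('a^'i::finite \<Rightarrow> 'v) \<Rightarrow> bool" where
  "parent_fun sV F \<phi> \<longleftrightarrow>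
     Vector_Spaces.linear (*s) sV \<phi> \<and> card F = CARD('i) \<and>
     (\<lambda>i. module.span sV {\<phi> (axis i 1)}) ` UNIV = (\<lambda>f. module.span sV {f}) ` F"

definition parent_code :: "('a::field^'i::finite \<Rightarrow> 'v::ab_group_add) \<Rightarrow> ('a^'i) set" where
  "parent_code \<phi> = {x. \<phi> x = 0}"

text \<open>Full hypotheses on a space with a parent function.\<close>
definition parent_setup ::
  "('a::field \<Rightarrow> 'v::ab_group_add \<Rightarrow> 'v) \<Rightarrow> 'v set \<Rightarrow> ('a^'i::finite \<Rightarrow> 'v) \<Rightarrow> bool" where
  "parent_setup sV F \<phi> \<longleftrightarrow> fd_space sV \<and> spanning_ppf sV F \<and> parent_fun sV F \<phi>"

definition hamming_wt :: "'a::zero^'i::finite \<Rightarrow> nat" where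
  "hamming_wt x = card {i. x $ i \<noteq> 0}"

definition hamming_isometry :: "('a::field^'i::finite \<Rightarrow> 'a^'i) \<Rightarrow> bool" where
  "hamming_isometry L \<longleftrightarrow> Vector_Spaces.linear (*s) (*s) L \<and> bij L \<and>
     (\<forall>x. hamming_wt (L x) = hamming_wt x)"

text \<open>The set H(P_V, P_W).\<close>
definition Hset :: "('a::field^'i::finite) set \<Rightarrow> ('a^'i) set \<Rightarrow> ('a^'i \<Rightarrow> 'a^'i) set" where
  "Hset PV PW = {L. hamming_isometry L \<and> L ` PV = PW}"

text \<open>Projective isometries (V, wt_FV) -> (W, wt_FW).\<close>
definition proj_isom ::
  "('a::field \<Rightarrow> 'v::ab_group_add \<Rightarrow> 'v) \<Rightarrow> 'v set \<Rightarrow>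
   ('a \<Rightarrow> 'w::ab_group_add \<Rightarrow> 'w) \<Rightarrow> 'w set \<Rightarrow> ('v \<Rightarrow> 'w) set" where
  "proj_isom sV FV sW FW = {L. Vector_Spaces.linear sV sW L \<and> bij L \<and>
      (\<forall>x. proj_wt sW FW (L x) = proj_wt sV FV x)}"

text \<open>The map Phi: Lhat to the unique projective isometry L with L o phiV = phiW o Lhat.\<close>
definition Phi ::
  "('a::field \<Rightarrow> 'v::ab_group_add \<Rightarrow> 'v) \<Rightarrow> 'v set \<Rightarrow> ('a^'i::finite \<Rightarrow> 'v) \<Rightarrow>
   ('a \<Rightarrow> 'w::ab_group_add \<Rightarrow> 'w) \<Rightarrow> 'w set \<Rightarrow> ('a^'i \<Rightarrow> 'w) \<Rightarrow>
   ('a^'i \<Rightarrow> 'a^'i) \<Rightarrow> ('v \<Rightarrow> 'w)" where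
  "Phi sV FV \<phi>V sW FW \<phi>W Lh =
     (THE L. L \<in> proj_isom sV FV sW FW \<and> L \<circ> \<phi>V = \<phi>W \<circ> Lh)"

end

theory Submission
  imports Defs
begin

text \<open>
  For a parent function \<open>\<phi>\<close>, the projective weight of \<open>v\<close> is the least Hamming weight
  in the coset \<open>\<phi>\<^sup>-\<^sup>1(v)\<close>; in particular the vectors of projective weight at most one are
  exactly the images of vectors of Hamming weight at most one, and \<open>\<phi>\<close> is injective on
  those, because the lines \<open>\<langle>\<phi>(e\<^sub>i)\<rangle>\<close> are pairwise distinct.
  Hence a Hamming isometry mapping \<open>P\<^sub>V\<close> onto \<open>P\<^sub>W\<close> respects the fibres of the parent
  functions and descends to a linear bijection \<open>V \<rightarrow> W\<close> preserving least coset weights.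
  Conversely, a projective isometry \<open>L\<close> sends each \<open>\<phi>\<^sub>V(e\<^sub>i)\<close> to some \<open>\<phi>\<^sub>W(y\<^sub>i)\<close> with
  \<open>wt(y\<^sub>i) \<le> 1\<close>, and the matrix with columns \<open>y\<^sub>i\<close> is a lift of \<open>L\<close> that does not
  increase Hamming weight. Lifting \<open>L\<^sup>-\<^sup>1\<close> in the same way, both composites are
  weight-non-increasing lifts of the identity, hence the identity on the standard basis and
  so everywhere; thus the lift is a Hamming isometry. The same injectivity makes lifts unique,
  and compatibility with composition and with subspaces is then formal.
\<close>

lemma Least_eq_if_mutually_dominated:
  fixes P Q :: "nat \<Rightarrow> bool"
  assumes ex: "\<exists>n. P n"
    and PQ: "\<And>n. P n \<Longrightarrow> \<exists>m\<le>n. Q m"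
    and QP: "\<And>n. Q n \<Longrightarrow> \<exists>m\<le>n. P m"
  shows "Least P = Least Q"
proof -
  obtain m where m: "m \<le> Least P" "Q m" using PQ[OF LeastI_ex[OF ex]] by blast
  obtain k where k: "k \<le> Least Q" "P k" using QP[OF LeastI[of Q, OF m(2)]] by blast
  have "Least P \<le> k" "Least Q \<le> m" using k(2) m(2) by (simp_all add: Least_le)
  then show ?thesis using k(1) m(1) by linarith
qed

lemma image_vimage_eq_vimage_image:
  assumes "bij h" "inj g" "g \<circ> f = k \<circ> h"
  shows "h ` (f -` D) = k -` (g ` D)"
proof
  have eq: "g (f x) = k (h x)" for x using assms(3) by (metis comp_apply)
  show "h ` (f -` D) \<subseteq> k -` (g ` D)" by (auto simp flip: eq)
  show "k -` (g ` D) \<subseteq> h ` (f -` D)"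
  proof
    fix y assume y: "y \<in> k -` (g ` D)"
    obtain x where x: "y = h x" using \<open>bij h\<close> by (metis bij_def surjD)
    have "g (f x) \<in> g ` D" using y x eq by simp
    then have "f x \<in> D" using \<open>inj g\<close> by (simp add: inj_image_mem_iff)
    then show "y \<in> h ` (f -` D)" using x by blast
  qed
qed

lemma surj_vimage_eq_iff: "surj f \<Longrightarrow> f -` A = f -` B \<longleftrightarrow> A = B"
  by (metis surj_image_vimage_eq)

lemma linear_axis_expansion:
  fixes f :: "'a::field^'i::finite \<Rightarrow> 'v::ab_group_add"
  assumes "Vector_Spaces.linear (*s) s f"
  shows "f x = (\<Sum>i\<in>UNIV. s (x$i) (f (axis i 1)))"
proof -
  interpret f: Vector_Spaces.linear "(*s)" s f by fact
  have "f x = f (\<Sum>i\<in>UNIV. (x$i) *s axis i 1)" by (simp add: basis_expansion)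
  also have "\<dots> = (\<Sum>i\<in>UNIV. s (x$i) (f (axis i 1)))" by (simp add: f.sum f.scale)
  finally show ?thesis .
qed

lemma linear_eq_on_axes:
  fixes f g :: "'a::field^'i::finite \<Rightarrow> 'v::ab_group_add"
  assumes "Vector_Spaces.linear (*s) s f" "Vector_Spaces.linear (*s) s g"
    and "\<And>i. f (axis i 1) = g (axis i 1)"
  shows "f = g"
proof
  fix x
  have "f x = (\<Sum>i\<in>UNIV. s (x$i) (f (axis i 1)))" by (rule linear_axis_expansion[OF assms(1)])
  also have "\<dots> = g x" by (simp add: assms(3) linear_axis_expansion[OF assms(2), of x])
  finally show "f x = g x" .
qed

lemma axis_eq_scale_axis: "axis i c = c *s axis i (1::'a::semiring_1)"
  by (simp add: vec_eq_iff axis_def)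

lemma matrix_vector_mult_axis: "(A::'a::comm_semiring_1^'n^'m) *v axis i 1 = column i A"
  by (simp add: matrix_mult_sum axis_def if_distrib[of "\<lambda>c. c *s _"] cong: if_cong)

lemma hamming_wt_axis: "hamming_wt (axis i c :: 'a::zero^'i::finite) \<le> 1"
  unfolding hamming_wt_def
  by (rule order_trans[OF card_mono[of "{i}"]]) (auto simp: axis_def)

lemma hamming_wt_le_1_iff: "hamming_wt (y :: 'a::zero^'i::finite) \<le> 1 \<longleftrightarrow> (\<exists>i c. y = axis i c)"
proof
  assume "hamming_wt y \<le> 1"
  then have "\<forall>j\<in>{j. y$j \<noteq> 0}. \<forall>k\<in>{j. y$j \<noteq> 0}. j = k"
    using card_le_Suc0_iff_eq[of "{j. y$j \<noteq> 0}"] by (simp add: hamming_wt_def)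
  then obtain i where "\<And>j. j \<noteq> i \<Longrightarrow> y$j = 0" by blast
  then have "y = axis i (y$i)" by (auto simp: vec_eq_iff axis_def)
  then show "\<exists>i c. y = axis i c" by blast
qed (metis hamming_wt_axis)

lemma support_subset_if_in_span_axes:
  fixes y :: "'a::field^'i::finite"
  assumes "y \<in> vec.span ((\<lambda>i. axis i 1) ` J)"
  shows "{i. y$i \<noteq> 0} \<subseteq> J"
proof -
  let ?S = "{y::'a^'i. \<forall>i. i \<notin> J \<longrightarrow> y$i = 0}"
  have "vec.subspace ?S" by (auto simp: vec.subspace_def)
  moreover have "(\<lambda>i. axis i 1) ` J \<subseteq> ?S" by (auto simp: axis_def)
  ultimately have "vec.span ((\<lambda>i. axis i 1) ` J) \<subseteq> ?S" by (rule vec.span_minimal[rotated])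
  then show ?thesis using assms by auto
qed

lemma hamming_wt_matrix_vector_mult_le:
  fixes A :: "'a::field^'n::finite^'m::finite"
  assumes "\<And>i. hamming_wt (column i A) \<le> 1"
  shows "hamming_wt (A *v x) \<le> hamming_wt x"
proof -
  define S where "S = {i. x$i \<noteq> 0}"
  have "(A *v x) $ j = 0" if "j \<notin> (\<Union>i\<in>S. {j. column i A $ j \<noteq> 0})" for j
    using that by (auto simp: matrix_mult_sum sum_component S_def intro!: sum.neutral)
  then have "{j. (A *v x) $ j \<noteq> 0} \<subseteq> (\<Union>i\<in>S. {j. column i A $ j \<noteq> 0})"
    by blast
  then have "hamming_wt (A *v x) \<le> card (\<Union>i\<in>S. {j. column i A $ j \<noteq> 0})"
    unfolding hamming_wt_def by (intro card_mono) auto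
  also have "\<dots> \<le> (\<Sum>i\<in>S. card {j. column i A $ j \<noteq> 0})" by (rule card_UN_le) simp
  also have "\<dots> \<le> (\<Sum>i\<in>S. 1)" using assms unfolding hamming_wt_def by (intro sum_mono) auto
  also have "\<dots> = hamming_wt x" unfolding S_def hamming_wt_def by simp
  finally show ?thesis .
qed

lemma parent_code_eq_vimage: "parent_code \<phi> = \<phi> -` {0}"
  by (auto simp: parent_code_def)

locale parent_space =
  fixes s :: "'a::{finite,field} \<Rightarrow> 'v::ab_group_add \<Rightarrow> 'v"
    and F :: "'v set"
    and \<phi> :: "'a^'i::finite \<Rightarrow> 'v"
  assumes parent_setup: "parent_setup s F \<phi>"
begin

lemma linear_phi: "Vector_Spaces.linear (*s) s \<phi>"
  using parent_setup unfolding parent_setup_def parent_fun_def by auto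

sublocale vs: vector_space s
  using parent_setup unfolding parent_setup_def fd_space_def by auto

sublocale lin: Vector_Spaces.linear "(*s)" s \<phi>
  by (rule linear_phi)

lemma lines_eq: "range (\<lambda>i. vs.span {\<phi> (axis i 1)}) = (\<lambda>f. vs.span {f}) ` F"
  using parent_setup unfolding parent_setup_def parent_fun_def by auto

lemma line_of_axis_in_F:
  obtains f where "f \<in> F" "vs.span {\<phi> (axis i 1)} = vs.span {f}"
proof -
  have "vs.span {\<phi> (axis i 1)} \<in> (\<lambda>f. vs.span {f}) ` F" unfolding lines_eq[symmetric] by (rule rangeI)
  then show ?thesis using that by (elim imageE) simp
qed

lemma line_of_F_is_axis_line:
  assumes "f \<in> F"
  obtains i where "vs.span {\<phi> (axis i 1)} = vs.span {f}"
proof -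
  have "vs.span {f} \<in> range (\<lambda>i. vs.span {\<phi> (axis i 1)})" unfolding lines_eq using assms by (rule imageI)
  then show ?thesis using that by (elim rangeE) simp
qed

lemma card_F: "card F = CARD('i)"
  using parent_setup unfolding parent_setup_def parent_fun_def by auto

lemma finite_F: "finite F"
  using card_F card_gt_0_iff[of F] by simp

lemma zero_notin_F: "0 \<notin> F"
  using parent_setup unfolding parent_setup_def spanning_ppf_def by auto

lemma span_F: "vs.span F = UNIV"
  using parent_setup unfolding parent_setup_def spanning_ppf_def by auto

lemma inj_on_lines_F: "inj_on (\<lambda>f. vs.span {f}) F"
proof (rule inj_onI)
  fix x y assume xy: "x \<in> F" "y \<in> F" "vs.span {x} = vs.span {y}"
  show "x = y"
  proof (rule ccontr)
    assume ne: "x \<noteq> y"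
    have "x \<in> vs.span {y}" using xy(3) vs.span_base[of x "{x}"] by auto
    then have "vs.dependent {x, y}"
      unfolding vs.dependent_def using ne by (intro bexI[of _ x]) (auto simp: insert_Diff_if)
    then show False
      using parent_setup xy ne unfolding parent_setup_def spanning_ppf_def by blast
  qed
qed

lemma inj_lines_axes: "inj (\<lambda>i. vs.span {\<phi> (axis i 1)})"
proof -
  have "card (range (\<lambda>i. vs.span {\<phi> (axis i 1)})) = card (UNIV :: 'i set)"
    using lines_eq card_image[OF inj_on_lines_F] card_F by simp
  then show ?thesis by (rule eq_card_imp_inj_on[OF finite])
qed

lemma span_singleton_eq_if_mem:
  assumes "a \<in> vs.span {b}" "a \<noteq> 0"
  shows "vs.span {a} = vs.span {b}"
proof -
  obtain k where k: "a = s k b" using assms(1) unfolding vs.span_singleton by auto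
  then have "b = s (inverse k) a" using assms(2) by simp
  then have "b \<in> vs.span {a}" by (simp add: vs.span_base vs.span_scale)
  then show ?thesis using assms(1) unfolding vs.span_eq by (auto intro: vs.span_base)
qed

lemma phi_axis_neq_0: "\<phi> (axis i 1) \<noteq> 0"
proof
  assume zero: "\<phi> (axis i 1) = 0"
  obtain f where f: "f \<in> F" "vs.span {\<phi> (axis i 1)} = vs.span {f}"
    by (rule line_of_axis_in_F)
  have "f \<in> vs.span {\<phi> (axis i 1)}" unfolding f(2) by (simp add: vs.span_base)
  then show False using zero f(1) zero_notin_F by simp
qed

lemma surj_phi: "surj \<phi>"
proof -
  have "F \<subseteq> range \<phi>"
  proof
    fix f assume "f \<in> F"
    then obtain i where "vs.span {\<phi> (axis i 1)} = vs.span {f}"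
      by (rule line_of_F_is_axis_line)
    then obtain k where "f = s k (\<phi> (axis i 1))"
      using vs.span_base[of f "{f}"] unfolding vs.span_singleton by auto
    then have "f = \<phi> (k *s axis i 1)" by (simp add: lin.scale)
    then show "f \<in> range \<phi>" by blast
  qed
  then have "vs.span F \<subseteq> range \<phi>"
    by (rule vs.span_minimal) (use lin.subspace_image[OF vec.subspace_UNIV] in simp)
  then show ?thesis using span_F by auto
qed

lemma inj_on_hamming_wt_le_1: "inj_on \<phi> {y. hamming_wt y \<le> 1}"
proof (rule inj_onI)
  fix y y' assume "y \<in> {y. hamming_wt y \<le> 1}" "y' \<in> {y. hamming_wt y \<le> 1}" and eq: "\<phi> y = \<phi> y'"
  then obtain j k c d where y: "y = axis j c" and y': "y' = axis k d"
    unfolding hamming_wt_le_1_iff by blast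
  have eq': "s c (\<phi> (axis j 1)) = s d (\<phi> (axis k 1))"
    using eq unfolding y y' axis_eq_scale_axis[of _ c] axis_eq_scale_axis[of _ d] lin.scale .
  show "y = y'"
  proof (cases "c = 0")
    case True
    then show ?thesis using eq' phi_axis_neq_0 y y' by (simp add: axis_eq_axis)
  next
    case False
    then have "\<phi> (axis j 1) = s (inverse c * d) (\<phi> (axis k 1))"
      using arg_cong[OF eq', of "s (inverse c)"] by simp
    then have "\<phi> (axis j 1) \<in> vs.span {\<phi> (axis k 1)}"
      by (simp add: vs.span_base vs.span_scale)
    then have "vs.span {\<phi> (axis j 1)} = vs.span {\<phi> (axis k 1)}"
      using phi_axis_neq_0 by (rule span_singleton_eq_if_mem)
    then have "j = k" using inj_lines_axes by (auto dest: injD)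
    then show ?thesis using eq' phi_axis_neq_0 y y' by simp
  qed
qed

lemma hamming_isometry_eqI:
  assumes "hamming_isometry A" "hamming_isometry B" "\<phi> \<circ> A = \<phi> \<circ> B"
  shows "A = B"
proof (rule linear_eq_on_axes)
  show "Vector_Spaces.linear (*s) (*s) A" "Vector_Spaces.linear (*s) (*s) B"
    using assms(1,2) unfolding hamming_isometry_def by auto
  fix i
  have "hamming_wt (A (axis i 1)) \<le> 1" "hamming_wt (B (axis i 1)) \<le> 1"
    using assms(1,2) hamming_wt_axis[of i 1] unfolding hamming_isometry_def by auto
  moreover have "\<phi> (A (axis i 1)) = \<phi> (B (axis i 1))"
    using assms(3) by (metis comp_apply)
  ultimately show "A (axis i 1) = B (axis i 1)" using inj_on_hamming_wt_le_1 by (auto dest: inj_onD)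
qed

lemma eq_id_if_hamming_wt_le_and_phi_invariant:
  assumes "Vector_Spaces.linear (*s) (*s) A"
    and "\<And>x. hamming_wt (A x) \<le> hamming_wt x" "\<And>x. \<phi> (A x) = \<phi> x"
  shows "A = id"
proof (rule linear_eq_on_axes[OF assms(1) vec.linear_id])
  fix i
  have "hamming_wt (A (axis i 1)) \<le> 1" using assms(2) hamming_wt_axis order_trans by blast
  then show "A (axis i 1) = id (axis i 1)"
    using inj_onD[OF inj_on_hamming_wt_le_1 assms(3)[of "axis i 1"]] hamming_wt_axis[of i 1] by simp
qed

lemma exists_preimage_hamming_wt_le_card:
  assumes "I \<subseteq> F" "finite I" "v \<in> vs.span I"
  shows "\<exists>y. \<phi> y = v \<and> hamming_wt y \<le> card I"
proof -
  have "\<forall>f\<in>I. \<exists>i. vs.span {\<phi> (axis i 1)} = vs.span {f}"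
    using assms(1) line_of_F_is_axis_line by (metis subsetD)
  then obtain g where g: "\<And>f. f \<in> I \<Longrightarrow> vs.span {\<phi> (axis (g f) 1)} = vs.span {f}"
    by metis
  define J where "J = g ` I"
  define A where "A = (\<lambda>i. axis i (1::'a)) ` J"
  have "I \<subseteq> vs.span (\<phi> ` A)"
  proof
    fix f assume f: "f \<in> I"
    have "f \<in> vs.span {f}" by (simp add: vs.span_base)
    then have "f \<in> vs.span {\<phi> (axis (g f) 1)}" by (simp add: g[OF f])
    also have "\<dots> \<subseteq> vs.span (\<phi> ` A)"
      using f unfolding A_def J_def by (intro vs.span_mono) auto
    finally show "f \<in> vs.span (\<phi> ` A)" .
  qed
  then have "vs.span I \<subseteq> vs.span (\<phi> ` A)" by (rule vs.span_minimal[OF _ vs.subspace_span])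
  then have "v \<in> \<phi> ` vec.span A" using assms(3) by (auto simp: lin.span_image)
  then obtain y where y: "y \<in> vec.span A" "\<phi> y = v" by blast
  have "hamming_wt y \<le> card J"
    unfolding hamming_wt_def using support_subset_if_in_span_axes[OF y(1)[unfolded A_def]]
    by (intro card_mono) (simp_all add: J_def assms(2))
  also have "\<dots> \<le> card I" unfolding J_def using assms(2) by (rule card_image_le)
  finally show ?thesis using y(2) by blast
qed

lemma exists_span_card_le_hamming_wt:
  "\<exists>I \<subseteq> F. finite I \<and> card I \<le> hamming_wt y \<and> \<phi> y \<in> vs.span I"
proof -
  have "\<forall>i. \<exists>f\<in>F. vs.span {\<phi> (axis i 1)} = vs.span {f}" using line_of_axis_in_F by metis
  then obtain h where h: "\<And>i. h i \<in> F" "\<And>i. vs.span {\<phi> (axis i 1)} = vs.span {h i}"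
    by metis
  define I where "I = h ` {i. y$i \<noteq> 0}"
  have "\<phi> y = (\<Sum>i\<in>UNIV. s (y$i) (\<phi> (axis i 1)))" by (rule linear_axis_expansion[OF linear_phi])
  also have "\<dots> \<in> vs.span I"
  proof (rule vs.span_sum)
    fix i
    show "s (y$i) (\<phi> (axis i 1)) \<in> vs.span I"
    proof (cases "y$i = 0")
      case False
      have "\<phi> (axis i 1) \<in> vs.span {\<phi> (axis i 1)}" by (simp add: vs.span_base)
      then have "\<phi> (axis i 1) \<in> vs.span {h i}" by (simp add: h(2))
      also have "\<dots> \<subseteq> vs.span I" using False unfolding I_def by (intro vs.span_mono) auto
      finally show ?thesis by (rule vs.span_scale)
    qed (simp add: vs.span_zero)
  qed
  moreover have "card I \<le> hamming_wt y" unfolding I_def hamming_wt_def by (rule card_image_le) simp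
  moreover have "I \<subseteq> F" using h(1) by (auto simp: I_def)
  ultimately show ?thesis by (auto simp: I_def)
qed

lemma proj_wt_eq_Min_hamming_wt: "proj_wt s F v = Min (hamming_wt ` (\<phi> -` {v}))"
proof -
  have "proj_wt s F v = (LEAST n. n \<in> hamming_wt ` (\<phi> -` {v}))"
    unfolding proj_wt_def
  proof (rule Least_eq_if_mutually_dominated)
    show "\<exists>n I. I \<subseteq> F \<and> finite I \<and> card I = n \<and> v \<in> vs.span I"
      using finite_F span_F by (intro exI[of _ "card F"] exI[of _ F]) simp
  next
    fix n assume "\<exists>I. I \<subseteq> F \<and> finite I \<and> card I = n \<and> v \<in> vs.span I"
    then obtain I where "I \<subseteq> F" "finite I" "card I = n" "v \<in> vs.span I" by blast
    then obtain y where "\<phi> y = v" "hamming_wt y \<le> n"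
      using exists_preimage_hamming_wt_le_card by blast
    then show "\<exists>m\<le>n. m \<in> hamming_wt ` (\<phi> -` {v})" by blast
  next
    fix n assume "n \<in> hamming_wt ` (\<phi> -` {v})"
    then obtain y where "\<phi> y = v" "hamming_wt y = n" by blast
    then show "\<exists>m\<le>n. \<exists>I. I \<subseteq> F \<and> finite I \<and> card I = m \<and> v \<in> vs.span I"
      using exists_span_card_le_hamming_wt[of y] by blast
  qed
  also have "\<dots> = Min (hamming_wt ` (\<phi> -` {v}))"
  proof -
    obtain x where "\<phi> x = v" using surj_phi by (metis surjD)
    then show ?thesis by (subst Least_Min) auto
  qed
  finally show ?thesis .
qed

lemma proj_wt_le_1_iff: "proj_wt s F v \<le> 1 \<longleftrightarrow> (\<exists>y. \<phi> y = v \<and> hamming_wt y \<le> 1)"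
proof -
  obtain x where "\<phi> x = v" using surj_phi by (metis surjD)
  then have "hamming_wt ` (\<phi> -` {v}) \<noteq> {}" by blast
  then show ?thesis by (auto simp: proj_wt_eq_Min_hamming_wt Min_le_iff)
qed

end

locale parent_space_pair = V: parent_space sV FV \<phi>V + W: parent_space sW FW \<phi>W
  for sV :: "'a::{finite,field} \<Rightarrow> 'v::ab_group_add \<Rightarrow> 'v" and FV :: "'v set"
    and \<phi>V :: "'a^'i::finite \<Rightarrow> 'v"
    and sW :: "'a \<Rightarrow> 'w::ab_group_add \<Rightarrow> 'w" and FW :: "'w set"
    and \<phi>W :: "'a^'i \<Rightarrow> 'w"
begin

abbreviation "PV \<equiv> parent_code \<phi>V"
abbreviation "PW \<equiv> parent_code \<phi>W"

lemma parent_eq_iff_if_Hset: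
  assumes "Lh \<in> Hset PV PW"
  shows "\<phi>W (Lh z) = \<phi>W (Lh x) \<longleftrightarrow> \<phi>V z = \<phi>V x"
proof -
  have "hamming_isometry Lh" and im: "Lh ` PV = PW" using assms unfolding Hset_def by auto
  then have "Vector_Spaces.linear (*s) (*s) Lh" and "inj Lh"
    unfolding hamming_isometry_def bij_def by auto
  then interpret Lh: Vector_Spaces.linear "(*s)" "(*s)" Lh by simp
  have "\<phi>W (Lh z) = \<phi>W (Lh x) \<longleftrightarrow> Lh (z - x) \<in> PW"
    by (simp add: parent_code_def Lh.diff W.lin.diff)
  also have "\<dots> \<longleftrightarrow> z - x \<in> PV" unfolding im[symmetric] using \<open>inj Lh\<close> by (simp add: inj_image_mem_iff)
  also have "\<dots> \<longleftrightarrow> \<phi>V z = \<phi>V x" by (simp add: parent_code_def V.lin.diff)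
  finally show ?thesis .
qed

lemma exists_proj_isom_induced_by_Hset:
  assumes H: "Lh \<in> Hset PV PW"
  shows "\<exists>L \<in> proj_isom sV FV sW FW. L \<circ> \<phi>V = \<phi>W \<circ> Lh"
proof -
  have lin_Lh: "Vector_Spaces.linear (*s) (*s) Lh" and "bij Lh"
    and hw: "hamming_wt \<circ> Lh = hamming_wt"
    using H by (auto simp: Hset_def hamming_isometry_def)
  interpret vector_space_pair "(*s)" sV
    by (intro vector_space_pair.intro vec.vector_space_axioms V.vs.vector_space_axioms)
  obtain g where g: "Vector_Spaces.linear sV (*s) g" "\<phi>V \<circ> g = id"
    using linear_surjective_right_inverse[OF V.linear_phi V.surj_phi] by blast
  \<comment> \<open>Any linear section \<open>g\<close> of \<open>\<phi>V\<close> will do, since \<open>Lh\<close> maps the fibres of \<open>\<phi>V\<close> onto those of \<open>\<phi>W\<close>.\<close>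
  define L where "L = \<phi>W \<circ> Lh \<circ> g"
  have L_phi: "L (\<phi>V x) = \<phi>W (Lh x)" for x
    using parent_eq_iff_if_Hset[OF H] pointfree_idE[OF g(2)] by (simp add: L_def)
  then have L_comp: "L \<circ> \<phi>V = \<phi>W \<circ> Lh" by auto
  have "Vector_Spaces.linear sV sW L"
    unfolding L_def
    by (rule Vector_Spaces.linear_compose[OF g(1) Vector_Spaces.linear_compose[OF lin_Lh W.linear_phi]])
  moreover have "inj L"
  proof (rule injI)
    fix u v assume "L u = L v"
    moreover obtain x y where "u = \<phi>V x" "v = \<phi>V y" using V.surj_phi by (metis surjD)
    ultimately show "u = v" using L_phi parent_eq_iff_if_Hset[OF H] by metis
  qed
  moreover have "surj L"
  proof -
    have "surj (\<phi>W \<circ> Lh)" using comp_surj[OF bij_is_surj[OF \<open>bij Lh\<close>] W.surj_phi] .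
    then have "UNIV = L ` range \<phi>V" by (simp add: image_comp L_comp)
    then show ?thesis by blast
  qed
  moreover have "proj_wt sW FW (L v) = proj_wt sV FV v" for v
  proof -
    have "\<phi>W -` {L v} = Lh ` (\<phi>V -` {v})"
      using image_vimage_eq_vimage_image[OF \<open>bij Lh\<close> \<open>inj L\<close> L_comp] by simp
    then have "hamming_wt ` (\<phi>W -` {L v}) = hamming_wt ` (\<phi>V -` {v})"
      by (simp add: image_comp hw)
    then show ?thesis by (simp add: V.proj_wt_eq_Min_hamming_wt W.proj_wt_eq_Min_hamming_wt)
  qed
  ultimately show ?thesis using L_comp unfolding proj_isom_def bij_def by blast
qed

lemma exists_lift_hamming_wt_nonincreasing:
  assumes lin: "Vector_Spaces.linear sV sW L"
    and wt: "\<And>v. proj_wt sV FV v \<le> 1 \<Longrightarrow> proj_wt sW FW (L v) \<le> 1"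
  shows "\<exists>Lh. Vector_Spaces.linear (*s) (*s) Lh \<and> \<phi>W \<circ> Lh = L \<circ> \<phi>V
    \<and> (\<forall>x. hamming_wt (Lh x) \<le> hamming_wt x)"
proof -
  have "\<exists>y. \<phi>W y = L (\<phi>V (axis i 1)) \<and> hamming_wt y \<le> 1" for i
  proof -
    have "proj_wt sV FV (\<phi>V (axis i 1)) \<le> 1"
      unfolding V.proj_wt_le_1_iff using hamming_wt_axis by blast
    then show ?thesis using wt unfolding W.proj_wt_le_1_iff by blast
  qed
  then obtain Y where Y: "\<And>i. \<phi>W (Y i) = L (\<phi>V (axis i 1))" "\<And>i. hamming_wt (Y i) \<le> 1"
    by metis
  define A :: "'a^'i^'i" where "A = (\<chi> j i. Y i $ j)"
  have col: "column i A = Y i" for i by (simp add: A_def column_def)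
  have "\<phi>W \<circ> (*v) A = L \<circ> \<phi>V"
  proof (rule linear_eq_on_axes)
    show "Vector_Spaces.linear (*s) sW (\<phi>W \<circ> (*v) A)" "Vector_Spaces.linear (*s) sW (L \<circ> \<phi>V)"
      by (rule Vector_Spaces.linear_compose[OF matrix_vector_mul_linear_gen W.linear_phi]
          Vector_Spaces.linear_compose[OF V.linear_phi lin])+
  qed (simp add: matrix_vector_mult_axis col Y(1))
  moreover have "hamming_wt (A *v x) \<le> hamming_wt x" for x
    by (rule hamming_wt_matrix_vector_mult_le) (unfold col, rule Y(2))
  ultimately show ?thesis using matrix_vector_mul_linear_gen by blast
qed

lemma exists_Hset_lift_of_proj_isom:
  assumes "L \<in> proj_isom sV FV sW FW"
  shows "\<exists>Lh \<in> Hset PV PW. L \<circ> \<phi>V = \<phi>W \<circ> Lh"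
proof -
  interpret WV: parent_space_pair sW FW \<phi>W sV FV \<phi>V
    by (intro parent_space_pair.intro W.parent_space_axioms V.parent_space_axioms)
  have lin: "Vector_Spaces.linear sV sW L" and "bij L"
    and wt: "\<And>v. proj_wt sW FW (L v) = proj_wt sV FV v"
    using assms unfolding proj_isom_def by auto
  interpret L: Vector_Spaces.linear sV sW L by (rule lin)
  interpret vector_space_pair sV sW
    by (intro vector_space_pair.intro V.vs.vector_space_axioms W.vs.vector_space_axioms)
  obtain g where g: "Vector_Spaces.linear sW sV g" "g \<circ> L = id"
    using linear_injective_left_inverse[OF lin bij_is_inj[OF \<open>bij L\<close>]] by blast
  have gL: "g (L v) = v" for v using pointfree_idE[OF g(2)] .
  have Lg: "L (g w) = w" for w using gL \<open>bij L\<close> by (metis bij_def surjD)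
  have wt_g: "proj_wt sV FV (g w) = proj_wt sW FW w" for w using wt[of "g w"] Lg by simp
  obtain Lh where Lh: "Vector_Spaces.linear (*s) (*s) Lh" "\<phi>W \<circ> Lh = L \<circ> \<phi>V"
      "\<And>x. hamming_wt (Lh x) \<le> hamming_wt x"
    using exists_lift_hamming_wt_nonincreasing[OF lin] wt by fastforce
  obtain Mh where Mh: "Vector_Spaces.linear (*s) (*s) Mh" "\<phi>V \<circ> Mh = g \<circ> \<phi>W"
      "\<And>x. hamming_wt (Mh x) \<le> hamming_wt x"
    using WV.exists_lift_hamming_wt_nonincreasing[OF g(1)] wt_g by fastforce
  have Lh_phi: "\<phi>W (Lh x) = L (\<phi>V x)" for x using Lh(2) by (metis comp_apply)
  have Mh_phi: "\<phi>V (Mh y) = g (\<phi>W y)" for y using Mh(2) by (metis comp_apply)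
  have "Mh \<circ> Lh = id"
    by (rule V.eq_id_if_hamming_wt_le_and_phi_invariant)
      (auto simp: Vector_Spaces.linear_compose[OF Lh(1) Mh(1)] Lh_phi Mh_phi gL
        intro: order_trans[OF Mh(3) Lh(3)])
  moreover have "Lh \<circ> Mh = id"
    by (rule W.eq_id_if_hamming_wt_le_and_phi_invariant)
      (auto simp: Vector_Spaces.linear_compose[OF Mh(1) Lh(1)] Lh_phi Mh_phi Lg
        intro: order_trans[OF Lh(3) Mh(3)])
  ultimately have "bij Lh" and "hamming_wt (Lh x) = hamming_wt x" for x
    using o_bij le_antisym[OF Lh(3) order_trans[OF Mh(3)[of "Lh x"]]]
    by (auto simp: pointfree_idE)
  moreover have "Lh ` PV = PW"
    using image_vimage_eq_vimage_image[OF \<open>bij Lh\<close> bij_is_inj[OF \<open>bij L\<close>] Lh(2)[symmetric]]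
    by (simp add: parent_code_eq_vimage L.zero)
  ultimately show ?thesis using Lh(1,2) by (auto simp: Hset_def hamming_isometry_def)
qed

lemma ex1_proj_isom_induced_by_Hset:
  assumes "Lh \<in> Hset PV PW"
  shows "\<exists>!L. L \<in> proj_isom sV FV sW FW \<and> L \<circ> \<phi>V = \<phi>W \<circ> Lh"
proof -
  have "L1 = L2" if "L1 \<circ> \<phi>V = \<phi>W \<circ> Lh" "L2 \<circ> \<phi>V = \<phi>W \<circ> Lh" for L1 L2 :: "'v \<Rightarrow> 'w"
    using surj_fun_eq[OF V.surj_phi] that by (metis comp_apply)
  then show ?thesis using exists_proj_isom_induced_by_Hset[OF assms] by blast
qed

lemma Phi_in_proj_isom:
  assumes "Lh \<in> Hset PV PW"
  shows "Phi sV FV \<phi>V sW FW \<phi>W Lh \<in> proj_isom sV FV sW FW"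
    and "Phi sV FV \<phi>V sW FW \<phi>W Lh \<circ> \<phi>V = \<phi>W \<circ> Lh"
  using theI'[OF ex1_proj_isom_induced_by_Hset[OF assms]] unfolding Phi_def by auto

lemma Phi_eqI:
  assumes "Lh \<in> Hset PV PW" "L \<in> proj_isom sV FV sW FW" "L \<circ> \<phi>V = \<phi>W \<circ> Lh"
  shows "Phi sV FV \<phi>V sW FW \<phi>W Lh = L"
  unfolding Phi_def using ex1_proj_isom_induced_by_Hset[OF assms(1)] by (rule the1_equality) (use assms in simp)

lemma bij_betw_Phi: "bij_betw (Phi sV FV \<phi>V sW FW \<phi>W) (Hset PV PW) (proj_isom sV FV sW FW)"
proof (rule bij_betw_imageI)
  show "inj_on (Phi sV FV \<phi>V sW FW \<phi>W) (Hset PV PW)"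
  proof (rule inj_onI)
    fix Lh1 Lh2 assume H: "Lh1 \<in> Hset PV PW" "Lh2 \<in> Hset PV PW"
      and eq: "Phi sV FV \<phi>V sW FW \<phi>W Lh1 = Phi sV FV \<phi>V sW FW \<phi>W Lh2"
    have "\<phi>W \<circ> Lh1 = \<phi>W \<circ> Lh2" using Phi_in_proj_isom(2)[OF H(1)] Phi_in_proj_isom(2)[OF H(2)] eq by simp
    then show "Lh1 = Lh2" using H W.hamming_isometry_eqI by (auto simp: Hset_def)
  qed
  show "Phi sV FV \<phi>V sW FW \<phi>W ` Hset PV PW = proj_isom sV FV sW FW"
  proof
    show "Phi sV FV \<phi>V sW FW \<phi>W ` Hset PV PW \<subseteq> proj_isom sV FV sW FW"
      using Phi_in_proj_isom(1) by blast
    show "proj_isom sV FV sW FW \<subseteq> Phi sV FV \<phi>V sW FW \<phi>W ` Hset PV PW"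
    proof
      fix L assume L: "L \<in> proj_isom sV FV sW FW"
      then obtain Lh where "Lh \<in> Hset PV PW" "L \<circ> \<phi>V = \<phi>W \<circ> Lh"
        using exists_Hset_lift_of_proj_isom by blast
      then show "L \<in> Phi sV FV \<phi>V sW FW \<phi>W ` Hset PV PW" using Phi_eqI L by (metis image_eqI)
    qed
  qed
qed

lemma Hset_vimage_eq_iff_Phi_image_eq:
  assumes H: "Lh \<in> Hset PV PW"
  shows "Lh ` (\<phi>V -` DV) = \<phi>W -` DW \<longleftrightarrow> Phi sV FV \<phi>V sW FW \<phi>W Lh ` DV = DW"
proof -
  let ?L = "Phi sV FV \<phi>V sW FW \<phi>W Lh"
  have "bij Lh" using H by (simp add: Hset_def hamming_isometry_def)
  moreover have "inj ?L" using Phi_in_proj_isom(1)[OF H] by (simp add: proj_isom_def bij_is_inj)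
  ultimately have "Lh ` (\<phi>V -` DV) = \<phi>W -` (?L ` DV)"
    by (rule image_vimage_eq_vimage_image[OF _ _ Phi_in_proj_isom(2)[OF H]])
  then show ?thesis by (simp add: surj_vimage_eq_iff[OF W.surj_phi])
qed

lemma bij_betw_Phi_restrict:
  "bij_betw (Phi sV FV \<phi>V sW FW \<phi>W)
     {Lh \<in> Hset PV PW. Lh ` (\<phi>V -` DV) = \<phi>W -` DW}
     {L \<in> proj_isom sV FV sW FW. L ` DV = DW}"
  by (rule bij_betw_Collect[OF bij_betw_Phi]) (simp add: Hset_vimage_eq_iff_Phi_image_eq)

end

lemma Hset_comp:
  assumes "Lh \<in> Hset P1 P2" "Th \<in> Hset P2 P3"
  shows "Th \<circ> Lh \<in> Hset P1 P3"
  using assms Vector_Spaces.linear_compose bij_comp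
  by (fastforce simp: Hset_def hamming_isometry_def image_comp)

lemma proj_isom_comp:
  assumes "L \<in> proj_isom s1 F1 s2 F2" "T \<in> proj_isom s2 F2 s3 F3"
  shows "T \<circ> L \<in> proj_isom s1 F1 s3 F3"
  using assms Vector_Spaces.linear_compose bij_comp
  by (fastforce simp: proj_isom_def)

lemma Phi_comp:
  fixes s1 :: "'a::{finite,field} \<Rightarrow> 'u1::ab_group_add \<Rightarrow> 'u1"
  assumes U1: "parent_setup s1 F1 \<phi>1" and U2: "parent_setup s2 F2 \<phi>2"
    and U3: "parent_setup s3 F3 \<phi>3"
    and Lh: "Lh \<in> Hset (parent_code \<phi>1) (parent_code \<phi>2)"
    and Th: "Th \<in> Hset (parent_code \<phi>2) (parent_code \<phi>3)"
  shows "Phi s1 F1 \<phi>1 s3 F3 \<phi>3 (Th \<circ> Lh) = Phi s2 F2 \<phi>2 s3 F3 \<phi>3 Th \<circ> Phi s1 F1 \<phi>1 s2 F2 \<phi>2 Lh"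
proof -
  interpret P12: parent_space_pair s1 F1 \<phi>1 s2 F2 \<phi>2
    using U1 U2 by (simp add: parent_space_pair_def parent_space_def)
  interpret P23: parent_space_pair s2 F2 \<phi>2 s3 F3 \<phi>3
    using U2 U3 by (simp add: parent_space_pair_def parent_space_def)
  interpret P13: parent_space_pair s1 F1 \<phi>1 s3 F3 \<phi>3
    using U1 U3 by (simp add: parent_space_pair_def parent_space_def)
  show ?thesis
  proof (rule P13.Phi_eqI)
    show "Th \<circ> Lh \<in> Hset (parent_code \<phi>1) (parent_code \<phi>3)" using Lh Th by (rule Hset_comp)
    show "Phi s2 F2 \<phi>2 s3 F3 \<phi>3 Th \<circ> Phi s1 F1 \<phi>1 s2 F2 \<phi>2 Lh \<in> proj_isom s1 F1 s3 F3"
      using P12.Phi_in_proj_isom(1)[OF Lh] P23.Phi_in_proj_isom(1)[OF Th] by (rule proj_isom_comp)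
    show "Phi s2 F2 \<phi>2 s3 F3 \<phi>3 Th \<circ> Phi s1 F1 \<phi>1 s2 F2 \<phi>2 Lh \<circ> \<phi>1 = \<phi>3 \<circ> (Th \<circ> Lh)"
      using P12.Phi_in_proj_isom(2)[OF Lh] P23.Phi_in_proj_isom(2)[OF Th] by (metis comp_assoc)
  qed
qed

theorem theorem4p1:
  fixes sV :: "'a::{finite,field} \<Rightarrow> 'v::ab_group_add \<Rightarrow> 'v"
    and sW :: "'a \<Rightarrow> 'w::ab_group_add \<Rightarrow> 'w"
    and FV :: "'v set" and FW :: "'w set"
    and \<phi>V :: "'a^'i::finite \<Rightarrow> 'v" and \<phi>W :: "'a^'i \<Rightarrow> 'w"
    and s1 :: "'a \<Rightarrow> 'u1::ab_group_add \<Rightarrow> 'u1"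
    and s2 :: "'a \<Rightarrow> 'u2::ab_group_add \<Rightarrow> 'u2"
    and s3 :: "'a \<Rightarrow> 'u3::ab_group_add \<Rightarrow> 'u3"
    and F1 :: "'u1 set" and F2 :: "'u2 set" and F3 :: "'u3 set"
    and \<phi>1 :: "'a^'i \<Rightarrow> 'u1" and \<phi>2 :: "'a^'i \<Rightarrow> 'u2" and \<phi>3 :: "'a^'i \<Rightarrow> 'u3"
  assumes V: "parent_setup sV FV \<phi>V"
    and W: "parent_setup sW FW \<phi>W"
    and U1: "parent_setup s1 F1 \<phi>1"
    and U2: "parent_setup s2 F2 \<phi>2"
    and U3: "parent_setup s3 F3 \<phi>3"
  shows
    \<comment> \<open>(a)\<close>
    "(\<forall>Lh \<in> Hset (parent_code \<phi>V) (parent_code \<phi>W).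
        \<exists>!L. L \<in> proj_isom sV FV sW FW \<and> L \<circ> \<phi>V = \<phi>W \<circ> Lh)
     \<and> bij_betw (Phi sV FV \<phi>V sW FW \<phi>W)
         (Hset (parent_code \<phi>V) (parent_code \<phi>W)) (proj_isom sV FV sW FW)
     \<comment> \<open>(b)\<close>
     \<and> (\<forall>Lh \<in> Hset (parent_code \<phi>1) (parent_code \<phi>2).
        \<forall>Th \<in> Hset (parent_code \<phi>2) (parent_code \<phi>3).
          Phi s1 F1 \<phi>1 s3 F3 \<phi>3 (Th \<circ> Lh)
            = Phi s2 F2 \<phi>2 s3 F3 \<phi>3 Th \<circ> Phi s1 F1 \<phi>1 s2 F2 \<phi>2 Lh)
     \<comment> \<open>(c)\<close>
     \<and> (\<forall>DV DW. module.subspace sV DV \<longrightarrow> module.subspace sW DW \<longrightarrow>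
          bij_betw (Phi sV FV \<phi>V sW FW \<phi>W)
            {Lh \<in> Hset (parent_code \<phi>V) (parent_code \<phi>W). Lh ` (\<phi>V -` DV) = \<phi>W -` DW}
            {L \<in> proj_isom sV FV sW FW. L ` DV = DW})"
proof -
  interpret VW: parent_space_pair sV FV \<phi>V sW FW \<phi>W
    using V W by (simp add: parent_space_pair_def parent_space_def)
  show ?thesis
    using VW.ex1_proj_isom_induced_by_Hset VW.bij_betw_Phi VW.bij_betw_Phi_restrict
      Phi_comp[OF U1 U2 U3]
    by blast
qed

end
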